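(* Let $X$ be a real-valued random variable with a density $f\colon\mathbb{R}\to\mathbb{R}$ such that $TV(f)<\infty$. Then $nX\bmod 1\to U[0,1)$ in distribution as $n\to\infty$. Moreover, $$\delta\big(nX\bmod 1,\,U[0,1)\big)\le\frac{TV(f)}{4n}\quad\text{for all }n\in\mathbb{N}.$$
   Context: Here $\mathbb{N}$ is the set of positive integers. For a real number $x$, $x\bmod 1=x-\lfloor x\rfloor\in[0,1)$. $U[0,1)$ denotes the uniform distribution on $[0,1)$. The total variation distance between (the distributions of) two real random variables $X,Y$ is $\delta(X,Y)=\sup\{|P(X\in A)-P(Y\in A)| : A\subseteq\mathbb{R}\text{ Borel}\}$. For $f\colon\mathbb{R}\to\mathbb{R}$, $TV(f)$ denotes the total variation of $f$ restricted to the minimal integer-delineated interval containing its support: $$TV(f)=\sup\Big\{\sum_{j\in\mathbb{N}}|f(x_{j+1})-f(x_j)| : \{x_j\}_{j}\text{ is an increasing sequence in }(p,q)\Big\},$$ where $p=\inf\{k\in\mathbb{Z}: f([k,k+1))\ne\{0\}\}$ and $q=\sup\{k\in\mathbb{Z}: f((k-1,k])\ne\{0\}\}$; possibly $p=-\infty$ or $q=\infty$. *)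

theory Defs
  imports "HOL-Probability.Probability"
begin

definition supp_lower :: "(real \<Rightarrow> real) \<Rightarrow> ereal" where
  "supp_lower f =
     (INF k\<in>{k::int. f ` {real_of_int k..<real_of_int k + 1} \<noteq> {0}}. ereal (real_of_int k))"

definition supp_upper :: "(real \<Rightarrow> real) \<Rightarrow> ereal" where
  "supp_upper f =
     (SUP k\<in>{k::int. f ` {real_of_int k - 1<..real_of_int k} \<noteq> {0}}. ereal (real_of_int k))"

text \<open>
  The two end points are extended reals, so the delineating interval may be unbounded. Sequences
  are increasing in the weak sense; requiring strict monotonicity gives the same supremum.
\<close>
definition total_variation :: "(real \<Rightarrow> real) \<Rightarrow> ennreal" where
  "total_variation f =
     (SUP x\<in>{x :: nat \<Rightarrow> real. incseq x \<and> (\<forall>j. supp_lower f < ereal (x j) \<and> ereal (x j) < supp_upper f)}.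
        \<Sum>j. ennreal \<bar>f (x (Suc j)) - f (x j)\<bar>)"

text \<open>
  This is meant for probability measures on the Borel sets, where the real-valued supremum
  ranges over a subset of the unit interval and is therefore a genuine one.
\<close>
definition tv_dist :: "real measure \<Rightarrow> real measure \<Rightarrow> real" where
  "tv_dist \<mu> \<nu> = (SUP A\<in>sets (borel :: real measure). \<bar>measure \<mu> A - measure \<nu> A\<bar>)"

end

theory Submission
  imports Defs
begin

text \<open>
  Cut the line into the cells \<open>(k/n, (k+1)/n)\<close>. If \<open>a\<close> is the Lebesgue measure of \<open>A \<subseteq> [0,1)\<close>,
  then \<open>B = {x. frac (n x) \<in> A}\<close> occupies the proportion \<open>a\<close> of every cell \<open>C\<close>, and
  \<open>P(B \<inter> C) - a P(C) = (1 - a) P(B \<inter> C) - a P(C - B)\<close>. Comparing the mean of the density on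
  \<open>B \<inter> C\<close> and on \<open>C - B\<close> with values that the density takes in \<open>C\<close> bounds this by
  \<open>a (1 - a) / n \<le> 1 / (4 n)\<close> times a difference of two such values, and the differences over all
  cells add up to at most the total variation.
\<close>

section \<open>Finite sums of increments and the total variation\<close>

text \<open>A nonzero value at \<open>x\<close> makes \<open>j\<close> a competitor in the infimum
  and \<open>j + 1\<close> one in the supremum. So a single nonzero value admits every point of its
  open unit interval to the sequences in \<open>total_variation\<close>, including points where
  \<open>f\<close> vanishes.\<close>

lemma supp_bounds:
  assumes "f x \<noteq> 0" "real_of_int j < x" "x < real_of_int j + 1"
    and "real_of_int j < y" "y < real_of_int j + 1"
  shows "supp_lower f < ereal y" "ereal y < supp_upper f"
proof -
  have "f x \<in> f ` {real_of_int j..<real_of_int j + 1}" using assms by auto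
  then have "f ` {real_of_int j..<real_of_int j + 1} \<noteq> {0}" using assms(1) by blast
  then have "supp_lower f \<le> ereal (real_of_int j)"
    unfolding supp_lower_def by (intro INF_lower) simp
  also have "\<dots> < ereal y" using assms by simp
  finally show "supp_lower f < ereal y" .
  have "f x \<in> f ` {real_of_int (j + 1) - 1<..real_of_int (j + 1)}" using assms by auto
  then have "f ` {real_of_int (j + 1) - 1<..real_of_int (j + 1)} \<noteq> {0}" using assms(1) by blast
  then have "ereal (real_of_int (j + 1)) \<le> supp_upper f"
    unfolding supp_upper_def by (intro SUP_upper) simp
  moreover have "ereal y < ereal (real_of_int (j + 1))" using assms by simp
  ultimately show "ereal y < supp_upper f" by (rule less_le_trans[rotated])
qed

lemma sum_pairs_le_total_variation:
  fixes u v :: "nat \<Rightarrow> real"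
  assumes uv: "\<And>i. i < m \<Longrightarrow> u i \<le> v i"
    and vu: "\<And>i. Suc i < m \<Longrightarrow> v i \<le> u (Suc i)"
    and u: "\<And>i. i < m \<Longrightarrow> supp_lower f < ereal (u i) \<and> ereal (u i) < supp_upper f"
    and v: "\<And>i. i < m \<Longrightarrow> supp_lower f < ereal (v i) \<and> ereal (v i) < supp_upper f"
  shows "(\<Sum>i<m. ennreal \<bar>f (v i) - f (u i)\<bar>) \<le> total_variation f"
proof (cases "m = 0")
  case False
  \<comment> \<open>Competing sequences are infinite, so the finite list is continued by its last
    point \<open>v (m - 1)\<close>. Weak monotonicity allows this and the tail adds no increments; a
    last point exists because \<open>m\<close> is not 0.\<close>
  define x where "x j = (if j < 2 * m then if even j then u (j div 2) else v (j div 2)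
     else v (m - 1))" for j
  let ?d = "\<lambda>j. ennreal \<bar>f (x (Suc j)) - f (x j)\<bar>"
  have "x j \<le> x (Suc j)" for j
  proof (cases "even j")
    case True
    then show ?thesis using uv[of "j div 2"] by (auto simp: x_def)
  next
    case odd: False
    then obtain i where i: "j = 2 * i + 1" by (auto elim: oddE)
    then consider "Suc i < m" | "i = m - 1" | "m \<le> i" using False by linarith
    then show ?thesis
    proof cases
      case 1
      then show ?thesis using vu[of i] i by (auto simp: x_def)
    qed (use i False in \<open>auto simp: x_def\<close>)
  qed
  then have "incseq x" by (rule incseq_SucI)
  moreover have "supp_lower f < ereal (x j) \<and> ereal (x j) < supp_upper f" for j
    using u[of "j div 2"] v[of "j div 2"] v[of "m - 1"] False by (auto simp: x_def)
  ultimately have x: "(\<Sum>j. ?d j) \<le> total_variation f"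
    unfolding total_variation_def by (intro SUP_upper) auto
  have "(\<Sum>i<m. ennreal \<bar>f (v i) - f (u i)\<bar>) = (\<Sum>i<m. ?d (2 * i))"
    by (intro sum.cong) (auto simp: x_def)
  also have "\<dots> = (\<Sum>j\<in>(*) 2 ` {..<m}. ?d j)"
    by (subst sum.reindex) (auto simp: inj_on_def)
  also have "\<dots> \<le> (\<Sum>j. ?d j)"
    by (rule sum_le_suminf) auto
  finally show ?thesis using x by simp
qed simp

text \<open>Listing \<open>K\<close> in increasing order reduces the claim to pairs indexed by an
  initial segment of the naturals. This form suits cells, which are numbered by integers.\<close>

lemma sum_ordered_pairs_le_total_variation:
  fixes u v :: "'i::linorder \<Rightarrow> real"
  assumes "finite K"
    and uv: "\<And>k. k \<in> K \<Longrightarrow> u k \<le> v k"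
    and vu: "\<And>k l. k \<in> K \<Longrightarrow> l \<in> K \<Longrightarrow> k < l \<Longrightarrow> v k \<le> u l"
    and u: "\<And>k. k \<in> K \<Longrightarrow> supp_lower f < ereal (u k) \<and> ereal (u k) < supp_upper f"
    and v: "\<And>k. k \<in> K \<Longrightarrow> supp_lower f < ereal (v k) \<and> ereal (v k) < supp_upper f"
  shows "(\<Sum>k\<in>K. ennreal \<bar>f (v k) - f (u k)\<bar>) \<le> total_variation f"
proof -
  define l where "l = sorted_list_of_set K"
  have l: "set l = K" "distinct l" "sorted_wrt (<) l"
    using \<open>finite K\<close> by (auto simp: l_def)
  have bij: "bij_betw ((!) l) {..<length l} K"
    using l by (intro bij_betw_nth) auto
  have in_K: "l ! i \<in> K" if "i < length l" for i using l that by auto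
  have "(\<Sum>k\<in>K. ennreal \<bar>f (v k) - f (u k)\<bar>)
      = (\<Sum>i<length l. ennreal \<bar>f (v (l ! i)) - f (u (l ! i))\<bar>)"
    by (rule sum.reindex_bij_betw[OF bij, symmetric])
  also have "\<dots> \<le> total_variation f"
    using in_K sorted_wrt_nth_less[OF l(3)]
    by (intro sum_pairs_le_total_variation uv vu u v) auto
  finally show ?thesis .
qed

section \<open>Cells of length \<open>1 / n\<close>\<close>

lemma borel_measurable_frac [measurable]: "(frac :: real \<Rightarrow> real) \<in> borel_measurable borel"
  unfolding frac_def by measurable

text \<open>Open intervals leave out only countably many points of the line, and they lie strictly
  between consecutive integers, as the strict bounds in \<open>total_variation\<close>
  require.\<close>

definition cell :: "nat \<Rightarrow> int \<Rightarrow> real set" where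
  "cell n k = {real_of_int k / real n<..<(real_of_int k + 1) / real n}"

lemma cell_measurable [measurable]: "cell n k \<in> sets borel"
  by (simp add: cell_def)

lemma cell_iff: "0 < n \<Longrightarrow> x \<in> cell n k \<longleftrightarrow> real_of_int k < real n * x \<and> real n * x < real_of_int k + 1"
  by (auto simp: cell_def field_simps)

lemma frac_on_cell: "0 < n \<Longrightarrow> x \<in> cell n k \<Longrightarrow> frac (real n * x) = real n * x - real_of_int k"
  by (auto simp: cell_iff frac_def floor_eq_iff)

lemma cell_nonempty: "0 < n \<Longrightarrow> cell n k \<noteq> {}"
  by (simp add: cell_def divide_strict_right_mono not_le)

lemma cell_less:
  assumes "0 < n" "x \<in> cell n k" "y \<in> cell n l" "k < l"
  shows "x < y"
proof -
  have "real_of_int k + 1 \<le> real_of_int l" using assms(4) by linarith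
  moreover have "real n * x < real_of_int k + 1" "real_of_int l < real n * y"
    using assms by (auto simp: cell_iff)
  ultimately have "real n * x < real n * y" by linarith
  then show ?thesis by (simp add: mult_less_cancel_left)
qed

lemma disjoint_family_cell: "0 < n \<Longrightarrow> disjoint_family (cell n)"
  unfolding disjoint_family_on_def disjoint_iff
  by (metis cell_less less_irrefl linorder_neq_iff)

text \<open>Every integer is a multiple of \<open>1 / n\<close>, hence an end point of cells and
  never interior to one. Division of \<open>k\<close> by \<open>n\<close> finds the unit interval
  around the cell.\<close>

lemma cell_unit_interval:
  assumes "0 < n" "x \<in> cell n k"
  shows "real_of_int (k div int n) < x \<and> x < real_of_int (k div int n) + 1"
proof -
  define j where "j = k div int n"
  have "j * int n + k mod int n = k" by (simp add: j_def)
  moreover have "0 \<le> k mod int n" "k mod int n < int n" using assms(1) by simp_all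
  \<comment> \<open>The remainder is an integer below \<open>n\<close>, so it is at most
    \<open>n - 1\<close>; this leaves room for the right end point \<open>k + 1\<close>.\<close>
  ultimately have "j * int n \<le> k" and "k + 1 \<le> (j + 1) * int n"
    by (simp_all add: algebra_simps)
  then have 1: "real_of_int j * real n \<le> real_of_int k"
    by (metis of_int_le_iff of_int_mult of_int_of_nat_eq)
  from \<open>k + 1 \<le> (j + 1) * int n\<close>
  have "real_of_int (k + 1) \<le> real_of_int ((j + 1) * int n)" by (rule of_int_le_iff[THEN iffD2])
  then have 2: "real_of_int k + 1 \<le> (real_of_int j + 1) * real n" by simp
  have "real_of_int j * real n < real n * x" "real n * x < (real_of_int j + 1) * real n"
    using 1 2 assms(2) unfolding cell_iff[OF assms(1)] by linarith+
  then show ?thesis using assms(1) by (simp add: j_def mult.commute[of _ "real n"])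
qed

text \<open>Different cells are ordered like their indices, so only the two points within one cell
  may come in the wrong order. Taking their minimum and maximum sorts them without changing the
  absolute difference.\<close>

lemma sum_cells_le_total_variation:
  assumes "0 < n" "finite K"
    and s: "\<And>k. k \<in> K \<Longrightarrow> s k \<in> cell n k" and t: "\<And>k. k \<in> K \<Longrightarrow> t k \<in> cell n k"
  shows "(\<Sum>k\<in>K. ennreal \<bar>f (s k) - f (t k)\<bar>) \<le> total_variation f"
proof -
  \<comment> \<open>Cells where \<open>f\<close> vanishes at both points may lie outside the
    delineating interval, but they contribute 0. Each remaining cell contains a nonzero value and so
    lies inside.\<close>
  define K' where "K' = {k \<in> K. f (s k) \<noteq> 0 \<or> f (t k) \<noteq> 0}"
  define u where "u k = min (s k) (t k)" for k
  define v where "v k = max (s k) (t k)" for k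
  have uv: "u k \<in> cell n k" "v k \<in> cell n k" if "k \<in> K" for k
    using s[OF that] t[OF that] by (auto simp: u_def v_def min_def max_def)
  have supp: "supp_lower f < ereal y \<and> ereal y < supp_upper f" if k: "k \<in> K'" and y: "y \<in> cell n k" for k y
  proof -
    obtain x where "f x \<noteq> 0" "x \<in> cell n k" using k s t unfolding K'_def by blast
    then show ?thesis
      using cell_unit_interval[OF \<open>0 < n\<close>, of _ k] y supp_bounds[of f x "k div int n" y] by auto
  qed
  have "(\<Sum>k\<in>K. ennreal \<bar>f (s k) - f (t k)\<bar>) = (\<Sum>k\<in>K'. ennreal \<bar>f (s k) - f (t k)\<bar>)"
    using \<open>finite K\<close> by (intro sum.mono_neutral_right) (auto simp: K'_def)
  also have "\<dots> = (\<Sum>k\<in>K'. ennreal \<bar>f (v k) - f (u k)\<bar>)"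
    by (intro sum.cong refl) (auto simp: u_def v_def min_def max_def abs_minus_commute)
  also have "\<dots> \<le> total_variation f"
  proof (rule sum_ordered_pairs_le_total_variation)
    show "finite K'" using \<open>finite K\<close> by (simp add: K'_def)
    show "u k \<le> v k" for k by (simp add: u_def v_def)
    show "v k \<le> u l" if "k \<in> K'" "l \<in> K'" "k < l" for k l
      using that uv cell_less[OF \<open>0 < n\<close>, of "v k" k "u l" l] by (auto simp: K'_def)
  qed (use supp uv in \<open>auto simp: K'_def\<close>)
  finally show ?thesis .
qed

section \<open>Lengths and mean values on a cell\<close>

text \<open>The substitution \<open>x = (k + y) / n\<close> maps the open unit interval onto the
  cell, turns \<open>frac (n * x)\<close> into \<open>y\<close> and scales length by
  \<open>1 / n\<close>.\<close>

lemma emeasure_cell_frac: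
  assumes "0 < n" and [measurable]: "A \<in> sets borel"
  shows "emeasure lborel ({x. frac (real n * x) \<in> A} \<inter> cell n k)
    = ennreal (measure lborel (A \<inter> {0..<1}) / real n)"
proof -
  have fin: "emeasure lborel (A \<inter> {0..<1}) \<noteq> \<infinity>"
    using emeasure_mono[of "A \<inter> {0..<1}" "{0..<1::real}" lborel] by (auto simp: top_unique)
  have meas [measurable]: "{x. frac (real n * x) \<in> A} \<in> sets borel"
    by measurable
  let ?E = "{x. frac (real n * x) \<in> A} \<inter> cell n k"
  have pt: "real_of_int k / real n + 1 / real n * y \<in> ?E \<longleftrightarrow> y \<in> A \<inter> {0<..<1}" for y
  proof -
    have "real n * (real_of_int k / real n + 1 / real n * y) = real_of_int k + y"
      using assms(1) by (simp add: field_simps)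
    then show ?thesis using frac_on_cell[OF assms(1), of "real_of_int k / real n + 1 / real n * y" k]
      assms(1) by (auto simp: cell_iff)
  qed
  have "emeasure lborel ?E = (\<integral>\<^sup>+x. indicator ?E x \<partial>lborel)"
    by (rule nn_integral_indicator[symmetric]) simp
  also have "\<dots> = \<bar>1 / real n\<bar> * (\<integral>\<^sup>+y. indicator ?E (real_of_int k / real n + 1 / real n * y) \<partial>lborel)"
    by (rule nn_integral_real_affine) (use assms in auto)
  also have "(\<integral>\<^sup>+y. indicator ?E (real_of_int k / real n + 1 / real n * y) \<partial>lborel)
     = (\<integral>\<^sup>+y. indicator (A \<inter> {0<..<1}) y \<partial>lborel)"
    unfolding indicator_def pt ..
  also have "\<dots> = emeasure lborel (A \<inter> {0<..<1})"
    by (rule nn_integral_indicator) simp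
  \<comment> \<open>Only the null set containing the point 0 is added.\<close>
  also have "\<dots> = emeasure lborel (A \<inter> {0..<1})"
    by (rule emeasure_eq_AE) (use AE_lborel_singleton[of 0] in \<open>auto elim!: eventually_mono\<close>)
  also have "\<dots> = ennreal (measure lborel (A \<inter> {0..<1}))"
    using fin by (simp add: emeasure_eq_ennreal_measure)
  finally show ?thesis
    by (simp add: ennreal_mult[symmetric])
qed

text \<open>A mean value cannot exceed all values. The point is sought in the larger set
  \<open>C\<close> because \<open>E\<close> may be empty; for a null set \<open>E\<close> both sides
  are 0 and any point of \<open>C\<close> serves.\<close>

lemma set_integral_le_value:
  fixes h :: "'a \<Rightarrow> real"
  assumes h: "integrable M h" and E: "E \<in> sets M" "emeasure M E \<noteq> \<infinity>" and "E \<subseteq> C" "C \<noteq> {}"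
  shows "\<exists>s\<in>C. (LINT x:E|M. h x) \<le> h s * measure M E"
proof (cases "emeasure M E = 0")
  case True
  have "(LINT x:E|M. h x) = (LINT x:{}|M. h x)"
  proof (rule set_integral_cong_set)
    have "AE x in M. x \<notin> E" using True E(1) by (intro AE_not_in) auto
    then show "AE x in M. (x \<in> {}) = (x \<in> E)" by simp
  qed (use h E in \<open>auto simp: set_borel_measurable_def\<close>)
  also have "\<dots> = 0" by (simp add: set_lebesgue_integral_def)
  finally show ?thesis using True \<open>C \<noteq> {}\<close> by (auto simp: measure_def)
next
  case False
  then have pos: "measure M E > 0"
    using E(2) by (simp add: emeasure_eq_ennreal_measure zero_less_measure_iff)
  let ?I = "LINT x:E|M. h x"
  define c where "c = ?I / measure M E"
  have "\<exists>s\<in>E. c \<le> h s"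
  proof (rule ccontr)
    assume "\<not> (\<exists>s\<in>E. c \<le> h s)"
    then have less: "\<And>s. s \<in> E \<Longrightarrow> h s < c" by force
    \<comment> \<open>By the choice of \<open>c\<close> as the mean, \<open>?d\<close> has integral
      0, yet it would be positive on all of \<open>E\<close>; this forces \<open>E\<close> to be
      null.\<close>
    let ?d = "\<lambda>x. indicator E x * c - indicator E x * h x"
    have int: "integrable M (\<lambda>x. indicator E x * c)" "integrable M (\<lambda>x. indicator E x * h x)"
      using E integrable_mult_indicator[OF E(1) h] by (simp_all add: less_top)
    have "(\<integral>x. ?d x \<partial>M) = 0"
      using E pos int by (simp add: c_def set_lebesgue_integral_def)
    moreover have "AE x in M. 0 \<le> ?d x"
      using less by (intro AE_I2) (auto simp: indicator_def less_imp_le)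
    ultimately have "AE x in M. ?d x = 0"
      using integral_nonneg_eq_0_iff_AE[of M ?d] int by simp
    then have "AE x in M. x \<notin> E"
      by eventually_elim (use less in \<open>force simp: indicator_def\<close>)
    then show False
      using False E(1) AE_iff_null_sets[OF E(1)] by auto
  qed
  then show ?thesis using pos \<open>E \<subseteq> C\<close> by (auto simp: c_def field_simps)
qed

section \<open>Deviation from proportionality on finitely many cells\<close>

text \<open>The pieces \<open>B \<inter> C\<close> and \<open>C - B\<close> of the cell
  \<open>C\<close> have lengths \<open>a / n\<close> and \<open>(1 - a) / n\<close>, while their
  integrals enter the deviation with weights \<open>1 - a\<close> and \<open>- a\<close>. Both
  products have size \<open>a * (1 - a) / n\<close>, so a difference of two values of
  \<open>g\<close> remains.\<close>

lemma cell_deviation_le: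
  fixes g :: "real \<Rightarrow> real"
  assumes "0 < n" and A [measurable]: "A \<in> sets borel"
    and g: "integrable lborel g"
  defines "a \<equiv> measure lborel (A \<inter> {0..<1})"
    and "B \<equiv> {x. frac (real n * x) \<in> A}"
  shows "\<exists>s\<in>cell n k. \<exists>t\<in>cell n k.
    (LINT x:B \<inter> cell n k|lborel. g x) - a * (LINT x:cell n k|lborel. g x)
      \<le> a * (1 - a) / real n * (g s - g t)"
proof -
  let ?C = "cell n k" and ?I = "\<lambda>E. LINT x:E|lborel. g x"
  have [measurable]: "B \<in> sets borel" unfolding B_def by measurable
  have a: "0 \<le> a" "a \<le> 1"
    using measure_mono_fmeasurable[of "A \<inter> {0..<1}" "{0..<1::real}" lborel]
    by (auto simp: a_def fmeasurable_def)
  have E1: "emeasure lborel (B \<inter> ?C) = ennreal (a / n)"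
    unfolding a_def B_def by (rule emeasure_cell_frac) fact+
  have C: "emeasure lborel ?C = ennreal (1 / n)"
    using emeasure_cell_frac[OF \<open>0 < n\<close>, of UNIV k] by simp
  have "emeasure lborel (?C - B \<inter> ?C) = ennreal (1 / n) - ennreal (a / n)"
    unfolding E1[symmetric] C[symmetric] by (rule emeasure_Diff) (use E1 in auto)
  then have E2: "emeasure lborel (?C - B) = ennreal ((1 - a) / n)"
    using a by (simp add: Diff_Int ennreal_minus diff_divide_distrib)
  obtain s where s: "s \<in> ?C" "?I (B \<inter> ?C) \<le> g s * (a / n)"
    using set_integral_le_value[OF g, of "B \<inter> ?C" ?C] E1 a cell_nonempty[OF \<open>0 < n\<close>]
    by (auto simp: measure_def)
  \<comment> \<open>Using \<open>- g\<close> turns the upper bound by a value into a lower bound for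
    the integral of \<open>g\<close>.\<close>
  have "\<exists>t\<in>?C. (LINT x:?C - B|lborel. - g x) \<le> - g t * measure lborel (?C - B)"
    by (rule set_integral_le_value) (use g E2 cell_nonempty[OF \<open>0 < n\<close>] in auto)
  moreover have "(LINT x:?C - B|lborel. - g x) = - ?I (?C - B)"
    by (simp add: set_lebesgue_integral_def)
  ultimately obtain t where t: "t \<in> ?C" "g t * ((1 - a) / n) \<le> ?I (?C - B)"
    using E2 a by (auto simp: measure_def)
  have int: "set_integrable lborel E g" if "E \<in> sets borel" for E
    using g that unfolding set_integrable_def by (intro integrable_mult_indicator) auto
  have "?I ((B \<inter> ?C) \<union> (?C - B)) = ?I (B \<inter> ?C) + ?I (?C - B)"
    by (rule set_integral_Un) (auto intro!: int)
  moreover have "(B \<inter> ?C) \<union> (?C - B) = ?C" by auto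
  ultimately have "?I (B \<inter> ?C) - a * ?I ?C = (1 - a) * ?I (B \<inter> ?C) - a * ?I (?C - B)"
    by (simp add: algebra_simps)
  also have "\<dots> \<le> (1 - a) * (g s * (a / n)) - a * (g t * ((1 - a) / n))"
    using s t a by (intro diff_mono mult_left_mono) auto
  also have "\<dots> = a * (1 - a) / n * (g s - g t)"
    by (simp add: algebra_simps diff_divide_distrib)
  finally show ?thesis using s t by blast
qed

text \<open>The positive part appears because \<open>ennreal (f x)\<close> truncates negative values
  to 0. Truncation does not enlarge differences, so the total variation of \<open>f\<close> itself
  still controls the sum, uniformly in \<open>K\<close>.\<close>

lemma sum_cell_deviations_le:
  fixes f :: "real \<Rightarrow> real"
  assumes "0 < n" and A [measurable]: "A \<in> sets borel" and "finite K"
    and g: "integrable lborel (\<lambda>x. max 0 (f x))" and tv: "total_variation f < \<infinity>"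
  defines "a \<equiv> measure lborel (A \<inter> {0..<1})"
    and "B \<equiv> {x. frac (real n * x) \<in> A}"
  shows "(\<Sum>k\<in>K. (LINT x:B \<inter> cell n k|lborel. max 0 (f x)) - a * (LINT x:cell n k|lborel. max 0 (f x)))
    \<le> enn2real (total_variation f) / (4 * real n)"
proof -
  let ?V = "enn2real (total_variation f)"
  let ?D = "\<lambda>k. (LINT x:B \<inter> cell n k|lborel. max 0 (f x)) - a * (LINT x:cell n k|lborel. max 0 (f x))"
  have a: "0 \<le> a" "a \<le> 1"
    using measure_mono_fmeasurable[of "A \<inter> {0..<1}" "{0..<1::real}" lborel]
    by (auto simp: a_def fmeasurable_def)
  have "\<forall>k. \<exists>s t. s \<in> cell n k \<and> t \<in> cell n k \<and>
      ?D k \<le> a * (1 - a) / real n * (max 0 (f s) - max 0 (f t))"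
    using cell_deviation_le[OF \<open>0 < n\<close> A g] unfolding a_def B_def by blast
  then obtain s t where st: "\<And>k. s k \<in> cell n k" "\<And>k. t k \<in> cell n k"
    and D: "\<And>k. ?D k \<le> a * (1 - a) / real n * (max 0 (f (s k)) - max 0 (f (t k)))"
    by metis
  have "(\<Sum>k\<in>K. ennreal \<bar>f (s k) - f (t k)\<bar>) \<le> total_variation f"
    by (rule sum_cells_le_total_variation) (use assms st in auto)
  also have "total_variation f = ennreal ?V" using tv by simp
  finally have V: "(\<Sum>k\<in>K. \<bar>f (s k) - f (t k)\<bar>) \<le> ?V"
    by (simp add: sum_ennreal)
  \<comment> \<open>Source of the constant: \<open>a * (1 - a)\<close> is largest at
    \<open>a = 1 / 2\<close>, where it equals \<open>1 / 4\<close>.\<close>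
  have "0 \<le> (1 - 2 * a)\<^sup>2" by simp
  then have "a * (1 - a) \<le> 1 / 4" by (simp add: power2_eq_square algebra_simps)
  then have a4: "a * (1 - a) / real n \<le> 1 / 4 / real n"
    by (rule divide_right_mono) simp
  have "?D k \<le> 1 / 4 / real n * \<bar>f (s k) - f (t k)\<bar>" for k
  proof -
    have "?D k \<le> a * (1 - a) / real n * (max 0 (f (s k)) - max 0 (f (t k)))" by (rule D)
    also have "\<dots> \<le> a * (1 - a) / real n * \<bar>f (s k) - f (t k)\<bar>"
      using a by (intro mult_left_mono) auto
    also have "\<dots> \<le> 1 / 4 / real n * \<bar>f (s k) - f (t k)\<bar>"
      using a4 by (intro mult_right_mono) auto
    finally show ?thesis .
  qed
  then have "(\<Sum>k\<in>K. ?D k) \<le> (\<Sum>k\<in>K. 1 / 4 / real n * \<bar>f (s k) - f (t k)\<bar>)"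
    by (rule sum_mono)
  also have "\<dots> = 1 / 4 / real n * (\<Sum>k\<in>K. \<bar>f (s k) - f (t k)\<bar>)"
    by (simp only: sum_distrib_left)
  also have "\<dots> \<le> 1 / 4 / real n * ?V"
    using V by (intro mult_left_mono) auto
  finally show ?thesis by simp
qed

section \<open>From finitely many cells to the whole line\<close>

lemma AE_in_some_cell:
  assumes "0 < n"
  shows "AE x in lborel. \<exists>k. x \<in> cell n k"
proof -
  have "AE x in lborel. \<forall>k::int. x \<noteq> real_of_int k / real n"
    unfolding AE_all_countable by (intro allI AE_lborel_singleton)
  then show ?thesis
  proof eventually_elim
    case (elim x)
    have "real_of_int \<lfloor>real n * x\<rfloor> \<noteq> real n * x"
      using elim[rule_format, of "\<lfloor>real n * x\<rfloor>"] assms by (auto simp: field_simps)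
    then have "x \<in> cell n \<lfloor>real n * x\<rfloor>"
      unfolding cell_iff[OF assms] by linarith
    then show ?case ..
  qed
qed

text \<open>The bound for finitely many cells does not depend on their number, so it survives the
  limit over unions that exhaust the line up to a null set. One sign suffices here, since replacing
  \<open>A\<close> by its complement reverses the deviation.\<close>

lemma frac_deviation_le:
  fixes f :: "real \<Rightarrow> real" and \<mu> :: "real measure"
  assumes "0 < n" and A [measurable]: "A \<in> sets borel"
    and \<mu>: "prob_space \<mu>" "\<mu> = density lborel (\<lambda>x. ennreal (f x))"
    and f [measurable]: "(\<lambda>x. ennreal (f x)) \<in> borel_measurable borel"
    and tv: "total_variation f < \<infinity>"
  shows "measure \<mu> {x. frac (real n * x) \<in> A} - measure lborel (A \<inter> {0..<1})
    \<le> enn2real (total_variation f) / (4 * real n)"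
proof -
  interpret prob_space \<mu> by fact
  define a where "a = measure lborel (A \<inter> {0..<1})"
  define B where "B = {x. frac (real n * x) \<in> A}"
  have B [measurable]: "B \<in> sets borel" unfolding B_def by measurable
  have sets_\<mu> [measurable_cong, simp]: "sets \<mu> = sets borel" by (simp add: \<mu>(2))
  \<comment> \<open>\<open>g\<close> is a nonnegative real-valued version of the density. Its
    measurability comes from that of \<open>ennreal (f x)\<close>, as \<open>f\<close> itself is not
    assumed measurable.\<close>
  define g where "g x = max 0 (f x)" for x
  have g_eq: "g x = enn2real (ennreal (f x))" for x
    by (simp add: g_def max_def ennreal_neg)
  have g_ennreal: "ennreal (f x) = ennreal (g x)" for x
    by (simp add: g_def max_def ennreal_neg)
  have [measurable]: "g \<in> borel_measurable borel" unfolding g_eq[abs_def] by measurable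
  have g_nonneg: "0 \<le> g x" for x by (simp add: g_def)
  have "(\<integral>\<^sup>+x. ennreal (g x) \<partial>lborel) = emeasure \<mu> (space \<mu>)"
    by (simp add: \<mu>(2) emeasure_density g_ennreal)
  then have g_int: "integrable lborel g"
    using emeasure_space_1 g_nonneg by (intro integrableI_nonneg) auto
  have meas: "measure \<mu> E = (LINT x:E|lborel. g x)" if [measurable]: "E \<in> sets borel" for E
  proof -
    have "emeasure \<mu> E = (\<integral>\<^sup>+x. ennreal (indicator E x * g x) \<partial>lborel)"
      unfolding \<mu>(2) g_ennreal using g_nonneg
      by (subst emeasure_density) (auto intro!: nn_integral_cong simp: indicator_def)
    also have "\<dots> = ennreal (\<integral>x. indicator E x * g x \<partial>lborel)"
      using integrable_mult_indicator[OF _ g_int, of E] g_nonneg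
      by (intro nn_integral_eq_integral) auto
    finally show ?thesis
      using g_nonneg by (simp add: measure_def set_lebesgue_integral_def integral_nonneg_AE)
  qed
  define U where "U N = (\<Union>k\<in>{- int N..<int N}. cell n k)" for N
  have U [measurable]: "U N \<in> sets borel" for N unfolding U_def by measurable
  have prob_U: "measure \<mu> (E \<inter> U N) = (\<Sum>k\<in>{- int N..<int N}. measure \<mu> (E \<inter> cell n k))"
    if "E \<in> sets borel" for E N
  proof -
    have "E \<inter> U N = (\<Union>k\<in>{- int N..<int N}. E \<inter> cell n k)" by (auto simp: U_def)
    moreover have "disjoint_family_on (\<lambda>k. E \<inter> cell n k) {- int N..<int N}"
      using disjoint_family_cell[OF \<open>0 < n\<close>] by (fastforce simp: disjoint_family_on_def)
    ultimately show ?thesis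
      using that finite_measure_finite_Union[of "{- int N..<int N}" "\<lambda>k. E \<inter> cell n k"]
      by (simp only:) (auto simp: image_subset_iff)
  qed
  have AE_\<mu>: "AE x in \<mu>. \<exists>k. x \<in> cell n k"
    using AE_in_some_cell[OF \<open>0 < n\<close>] unfolding \<mu>(2) by (subst AE_density) auto
  have lim: "(\<lambda>N. measure \<mu> (E \<inter> U N)) \<longlonglongrightarrow> measure \<mu> E" if [measurable]: "E \<in> sets borel" for E
  proof -
    have "(\<lambda>N. measure \<mu> (E \<inter> U N)) \<longlonglongrightarrow> measure \<mu> (\<Union>N. E \<inter> U N)"
      by (rule finite_Lim_measure_incseq) (auto simp: incseq_def U_def, force)
    also have "measure \<mu> (\<Union>N. E \<inter> U N) = measure \<mu> E"
    proof (rule finite_measure_eq_AE)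
      show "AE x in \<mu>. (x \<in> (\<Union>N. E \<inter> U N)) = (x \<in> E)"
        using AE_\<mu>
      proof eventually_elim
        case (elim x)
        then obtain k where "x \<in> cell n k" ..
        \<comment> \<open>The summand 1 is there because the index range of \<open>U N\<close>
          excludes \<open>int N\<close>.\<close>
        then have "x \<in> U (nat (\<bar>k\<bar> + 1))" unfolding U_def by (intro UN_I[of k]) auto
        then show ?case by auto
      qed
    qed auto
    finally show ?thesis .
  qed
  \<comment> \<open>Writing the mass of \<open>U N\<close> with \<open>UNIV\<close> lets the same
    limit statement serve both terms; the second limit is then \<open>a\<close> times the total mass
    1.\<close>
  have "measure \<mu> (B \<inter> U N) - a * measure \<mu> (UNIV \<inter> U N)
      \<le> enn2real (total_variation f) / (4 * real n)" for N
  proof -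
    have "measure \<mu> (B \<inter> U N) - a * measure \<mu> (UNIV \<inter> U N)
      = (\<Sum>k\<in>{- int N..<int N}. measure \<mu> (B \<inter> cell n k) - a * measure \<mu> (cell n k))"
      using prob_U[OF B] prob_U[of UNIV] by (simp add: sum_subtractf sum_distrib_left)
    also have "\<dots> = (\<Sum>k\<in>{- int N..<int N}.
        (LINT x:B \<inter> cell n k|lborel. g x) - a * (LINT x:cell n k|lborel. g x))"
      by (simp add: meas)
    also have "\<dots> \<le> enn2real (total_variation f) / (4 * real n)"
      using sum_cell_deviations_le[OF \<open>0 < n\<close> A, of "{- int N..<int N}" f] g_int tv
      unfolding g_def[abs_def] a_def B_def by simp
    finally show ?thesis .
  qed
  moreover have "(\<lambda>N. measure \<mu> (B \<inter> U N) - a * measure \<mu> (UNIV \<inter> U N))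
      \<longlonglongrightarrow> measure \<mu> B - a * measure \<mu> UNIV"
    by (intro tendsto_diff tendsto_mult tendsto_const lim) auto
  ultimately have "measure \<mu> B - a * measure \<mu> UNIV \<le> enn2real (total_variation f) / (4 * real n)"
    by (intro LIMSEQ_le_const2) auto
  moreover have "measure \<mu> UNIV = 1"
    using prob_space by (simp add: \<mu>(2))
  ultimately show ?thesis by (simp add: a_def B_def)
qed

section \<open>Total variation bound and convergence in distribution for
  \<open>frac (n * X)\<close>\<close>

theorem corollary5:
  fixes M :: "'a measure" and X :: "'a \<Rightarrow> real" and f :: "real \<Rightarrow> real"
  assumes "prob_space M"
    and "distributed M lborel X (\<lambda>x. ennreal (f x))"
    and "AE x in lborel. 0 \<le> f x"
    and "total_variation f < \<infinity>"
  shows "weak_conv_m (\<lambda>n::nat. distr M borel (\<lambda>\<omega>. frac (real n * X \<omega>)))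
           (uniform_measure lborel {0..<1})
       \<and> (\<forall>n::nat\<ge>1. tv_dist (distr M borel (\<lambda>\<omega>. frac (real n * X \<omega>)))
             (uniform_measure lborel {0..<1})
           \<le> enn2real (total_variation f) / (4 * real n))"
proof -
  interpret prob_space M by fact
  let ?\<mu> = "distr M borel X"
  let ?P = "\<lambda>n::nat. distr M borel (\<lambda>\<omega>. frac (real n * X \<omega>))"
  let ?U = "uniform_measure lborel {0..<1::real}"
  let ?b = "\<lambda>n. enn2real (total_variation f) / (4 * real n)"
  have X [measurable]: "X \<in> borel_measurable M"
    using distributed_measurable[OF assms(2)] by simp
  have f: "(\<lambda>x. ennreal (f x)) \<in> borel_measurable borel"
    using distributed_borel_measurable[OF assms(2)] by simp
  have "distr M borel X = distr M lborel X" by (rule distr_cong) auto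
  then have \<mu>: "?\<mu> = density lborel (\<lambda>x. ennreal (f x))"
    using distributed_distr_eq_density[OF assms(2)] by simp
  have P: "measure (?P n) A = measure ?\<mu> {x. frac (real n * x) \<in> A}"
    if [measurable]: "A \<in> sets borel" for A n
    by (simp add: measure_distr vimage_def Int_def)
  have U: "measure ?U A = measure lborel (A \<inter> {0..<1})" if "A \<in> sets borel" for A
    using that by (simp add: measure_uniform_measure Int_commute)
  interpret U: prob_space ?U by (rule prob_space_uniform_measure) auto
  have P_prob: "prob_space (?P n)" for n by (rule prob_space_distr) measurable
  have le: "measure (?P n) A - measure ?U A \<le> ?b n" if "A \<in> sets borel" "1 \<le> n" for A n
    unfolding P[OF that(1)] U[OF that(1)]
    by (rule frac_deviation_le[OF _ that(1) _ \<mu> f assms(4)]) (use that in \<open>auto intro: prob_space_distr\<close>)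
  \<comment> \<open>Both measures have mass 1, so the one-sided bound for \<open>- A\<close> is the
    missing bound for \<open>A\<close>.\<close>
  have abs_le: "\<bar>measure (?P n) A - measure ?U A\<bar> \<le> ?b n" if A: "A \<in> sets borel" and "1 \<le> n" for A n
  proof -
    interpret P: prob_space "?P n" by (rule P_prob)
    have "measure (?P n) (- A) = 1 - measure (?P n) A" "measure ?U (- A) = 1 - measure ?U A"
      using A P.prob_compl[of A] U.prob_compl[of A] by (simp_all add: Compl_eq_Diff_UNIV)
    then show ?thesis using le[of A n] le[of "- A" n] that by (simp add: abs_le_iff)
  qed
  have "tv_dist (?P n) ?U \<le> ?b n" if "1 \<le> n" for n
    unfolding tv_dist_def by (rule cSUP_least) (use abs_le that in auto)
  moreover have "weak_conv_m ?P ?U"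
    unfolding weak_conv_m_def weak_conv_def cdf_def
  proof (intro allI impI)
    fix x :: real
    \<comment> \<open>The half-line \<open>{..x}\<close> is one of the Borel sets covered by
      \<open>abs_le\<close>, so the distribution functions converge at every \<open>x\<close>. The
      bound is used from \<open>n = 1\<close> on, since \<open>?b 0\<close> is 0 by the convention
      for division by 0.\<close>
    have "?b \<longlonglongrightarrow> 0" using lim_const_over_n[of "enn2real (total_variation f) / 4"] by simp
    then have "(\<lambda>n. measure (?P n) {..x} - measure ?U {..x}) \<longlonglongrightarrow> 0"
      by (rule Lim_null_comparison[rotated])
         (use abs_le in \<open>auto intro!: eventually_sequentiallyI[of 1]\<close>)
    then show "(\<lambda>n. measure (?P n) {..x}) \<longlonglongrightarrow> measure ?U {..x}"
      by (simp add: LIM_zero_iff)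
  qed
  ultimately show ?thesis by blast
qed

end
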